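(* Let $A\in\mathbb{R}^{m\times n}$, $b\in\mathbb{R}^m$, and let $\delta$ with $0\le\delta<\|b\|_\infty$ be the given target parameter. Let $(\hat x,\hat y)\in\mathbb{R}^n\times\mathbb{R}^m$ be an optimal pair for (P$_{\hat\delta}$) for some $0\le\hat\delta<\|b\|_\infty$. Let $J_P,I_P,J_D,I_D$ be the index sets associated with $(\hat x,\hat y,\hat\delta)$. Then the following four alternatives are equivalent. (I) There exists $e\in\mathbb{R}^m$ with $$-\operatorname{sign}(A\hat x-b)^\top e<0,\qquad A_{J_P}^\top e=0,\qquad (A_{J_D\setminus J_P}^\top\hat y)\odot(A_{J_D\setminus J_P}^\top e)\le 0,$$ $$-\operatorname{sign}(A^{I_P\setminus I_D}\hat x-b_{I_P\setminus I_D})\odot e_{I_P\setminus I_D}\le 0,\qquad e_{I_P^c}=0.$$ (II) There does not exist $d\in\mathbb{R}^n$ with $$A^{I_D}d=-\operatorname{sign}(\hat y_{I_D}),\qquad \operatorname{sign}(A^{I_P\setminus I_D}\hat x-b_{I_P\setminus I_D})\odot (A^{I_P\setminus I_D}d)\le-\mathbf{1},$$ $$(A_{J_D\setminus J_P}^\top\hat y)\odot d_{J_D\setminus J_P}\le 0,\qquad d_{J_D^c}=0.$$ (III) $(\hat x,0)$ is an optimal solution of the linear program $$\max_{(x,t)\in\mathbb{R}^n\times\mathbb{R}} t$$ subject to $$A^{I_D}x-b_{I_D}=(\hat\delta-t)\operatorname{sign}(\hat y_{I_D}),\qquad (t-\hat\delta)\mathbf{1}\le A^{I_D^c}x-b_{I_D^c}\le(\hat\delta-t)\mathbf{1},$$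 $$(A^\top\hat y)\odot x\le 0,\qquad x_{J_D^c}=0,\qquad t\le\hat\delta-\delta.$$ (IV) $\hat y$ is not an optimal solution of the linear program $$\min_{y\in\mathbb{R}^m}\ -\operatorname{sign}(A\hat x-b)^\top y$$ subject to $$-A_{J_P}^\top y=\operatorname{sign}(\hat x_{J_P}),\qquad -\mathbf{1}\le -A_{J_P^c}^\top y\le\mathbf{1},$$ $$-\operatorname{sign}(A\hat x-b)\odot y\le 0,\qquad y_{I_P^c}=0.$$
   Context: For $\eta\ge0$, (P$_\eta$) is the problem $\min_{x\in\mathbb{R}^n}\|x\|_1$ s.t. $\|Ax-b\|_\infty\le\eta$. The target parameter $\delta$ is the value of $\eta$ for which one ultimately wants to solve the problem. For a vector $z\in\mathbb{R}^p$, $\operatorname{Sign}(z)=\partial\|\cdot\|_1(z)=\{\xi\in[-1,1]^p: z_j\ne0\Rightarrow\xi_j=\operatorname{sign}(z_j)\}$; $\operatorname{sign}$ is the usual sign function (with $\operatorname{sign}(0)=0$), applied componentwise. A pair $(x^*,y^* )\in\mathbb{R}^n\times\mathbb{R}^m$ is called an optimal pair for (P$_\eta$) if $-A^\top y^*\in\operatorname{Sign}(x^* )$ and $Ax^*-b\in\eta\operatorname{Sign}(y^* )$ (so $x^*$ solves (P$_\eta$) and $y^*$ is a dual certificate). $a_i^\top$ denotes the $i$-th row and $A_j$ the $j$-th column of $A$. For index sets $I\subseteq\{1,\dots,m\}$, $J\subseteq\{1,\dots,n\}$, $A^I$ is the submatrix of rows indexed by $I$, $A_J$ the submatrix of columns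 indexed by $J$, $A_J^\top=(A_J)^\top$, and $v_I$ is the subvector of $v$ indexed by $I$. $\odot$ is the componentwise product, $\mathbf{1}$ the all-ones vector of appropriate size; inequalities between vectors are componentwise (and vacuous over empty index sets). The index sets associated with $(\hat x,\hat y,\hat\delta)$ are $J_P=\{j:\hat x_j\ne0\}$, $I_P=\{i:|a_i^\top\hat x-b_i|=\hat\delta\}$, $J_D=\{j:|A_j^\top\hat y|=1\}$, $I_D=\{i:\hat y_i\ne0\}$. Complements: $J^c=\{1,\dots,n\}\setminus J$ for the sets $J_P,J_D$ and $I^c=\{1,\dots,m\}\setminus I$ for $I_P,I_D$.
   Formalization: The formal theorem additionally assumes δ < δ̂ (the target is not yet reached); without it the equivalence fails: for δ̂ = δ, (III) holds trivially, and for δ̂ < δ, (x̂,0) is infeasible in (III), while (I) can be false or true respectively. *)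

theory Defs
  imports "HOL-Analysis.Analysis"
begin

text \<open>
  A matrix \<open>A\<close> with m rows and n columns has type \<open>real^'n^'m\<close>. The submatrices of rows in \<open>I\<close> or
  columns in \<open>J\<close> are not formed as objects: a relation between subvectors indexed by \<open>I\<close> is
  written as the bounded quantification over \<open>I\<close> of its components, with
  \<open>(A *v x) $ i\<close> for the product of row \<open>i\<close> with \<open>x\<close> and \<open>column j A \<bullet> y\<close> for the product of
  the transposed column \<open>j\<close> with \<open>y\<close>. The maximum norm is \<^const>\<open>infnorm\<close>.
\<close>

text \<open>The library's \<^const>\<open>sgn\<close> on \<open>real^'p\<close> is normalisation; here the sign is componentwise.\<close>

definition sign_vec :: "real^'p \<Rightarrow> real^'p" where
  "sign_vec z = (\<chi> j. sgn (z $ j))"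

definition Sign :: "real^'p \<Rightarrow> (real^'p) set" where
  "Sign z = {\<xi>. \<forall>j. \<xi> $ j \<in> {-1..1} \<and> (z $ j \<noteq> 0 \<longrightarrow> \<xi> $ j = sgn (z $ j))}"

definition optimal_pair ::
  "real^'n^'m \<Rightarrow> real^'m \<Rightarrow> real \<Rightarrow> real^'n \<Rightarrow> real^'m \<Rightarrow> bool" where
  "optimal_pair A b \<eta> x y \<longleftrightarrow>
     - (transpose A *v y) \<in> Sign x \<and> A *v x - b \<in> (\<lambda>\<xi>. \<eta> *\<^sub>R \<xi>) ` Sign y"

definition J_P :: "real^'n \<Rightarrow> 'n set" where
  "J_P x = {j. x $ j \<noteq> 0}"

definition I_P :: "real^'n^'m \<Rightarrow> real^'m \<Rightarrow> real \<Rightarrow> real^'n \<Rightarrow> 'm set" where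
  "I_P A b \<eta> x = {i. \<bar>(A *v x) $ i - b $ i\<bar> = \<eta>}"

definition J_D :: "real^'n^'m \<Rightarrow> real^'m \<Rightarrow> 'n set" where
  "J_D A y = {j. \<bar>column j A \<bullet> y\<bar> = 1}"

definition I_D :: "real^'m \<Rightarrow> 'm set" where
  "I_D y = {i. y $ i \<noteq> 0}"

definition dual_direction ::
  "real^'n^'m \<Rightarrow> real^'m \<Rightarrow> real \<Rightarrow> real^'n \<Rightarrow> real^'m \<Rightarrow> real^'m \<Rightarrow> bool" where
  "dual_direction A b \<delta>h xh yh e \<longleftrightarrow>
     - sign_vec (A *v xh - b) \<bullet> e < 0 \<and>
     (\<forall>j\<in>J_P xh. column j A \<bullet> e = 0) \<and>
     (\<forall>j\<in>J_D A yh - J_P xh. (column j A \<bullet> yh) * (column j A \<bullet> e) \<le> 0) \<and>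
     (\<forall>i\<in>I_P A b \<delta>h xh - I_D yh. - sgn ((A *v xh) $ i - b $ i) * e $ i \<le> 0) \<and>
     (\<forall>i\<in>- I_P A b \<delta>h xh. e $ i = 0)"

definition primal_direction ::
  "real^'n^'m \<Rightarrow> real^'m \<Rightarrow> real \<Rightarrow> real^'n \<Rightarrow> real^'m \<Rightarrow> real^'n \<Rightarrow> bool" where
  "primal_direction A b \<delta>h xh yh d \<longleftrightarrow>
     (\<forall>i\<in>I_D yh. (A *v d) $ i = - sgn (yh $ i)) \<and>
     (\<forall>i\<in>I_P A b \<delta>h xh - I_D yh. sgn ((A *v xh) $ i - b $ i) * (A *v d) $ i \<le> - 1) \<and>
     (\<forall>j\<in>J_D A yh - J_P xh. (column j A \<bullet> yh) * d $ j \<le> 0) \<and>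
     (\<forall>j\<in>- J_D A yh. d $ j = 0)"

definition primal_LP_feasible ::
  "real^'n^'m \<Rightarrow> real^'m \<Rightarrow> real \<Rightarrow> real \<Rightarrow> real^'m \<Rightarrow> (real^'n) \<times> real \<Rightarrow> bool" where
  "primal_LP_feasible A b \<delta> \<delta>h yh = (\<lambda>(x, t).
     (\<forall>i\<in>I_D yh. (A *v x) $ i - b $ i = (\<delta>h - t) * sgn (yh $ i)) \<and>
     (\<forall>i\<in>- I_D yh. t - \<delta>h \<le> (A *v x) $ i - b $ i \<and> (A *v x) $ i - b $ i \<le> \<delta>h - t) \<and>
     (\<forall>j. (transpose A *v yh) $ j * x $ j \<le> 0) \<and>
     (\<forall>j\<in>- J_D A yh. x $ j = 0) \<and>
     t \<le> \<delta>h - \<delta>)"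

definition dual_LP_feasible ::
  "real^'n^'m \<Rightarrow> real^'m \<Rightarrow> real \<Rightarrow> real^'n \<Rightarrow> real^'m \<Rightarrow> bool" where
  "dual_LP_feasible A b \<delta>h xh y \<longleftrightarrow>
     (\<forall>j\<in>J_P xh. - (column j A \<bullet> y) = sgn (xh $ j)) \<and>
     (\<forall>j\<in>- J_P xh. - 1 \<le> - (column j A \<bullet> y) \<and> - (column j A \<bullet> y) \<le> 1) \<and>
     (\<forall>i. - sgn ((A *v xh) $ i - b $ i) * y $ i \<le> 0) \<and>
     (\<forall>i\<in>- I_P A b \<delta>h xh. y $ i = 0)"

definition alternative_I ::
  "real^'n^'m \<Rightarrow> real^'m \<Rightarrow> real \<Rightarrow> real^'n \<Rightarrow> real^'m \<Rightarrow> bool" where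
  "alternative_I A b \<delta>h xh yh \<longleftrightarrow> (\<exists>e. dual_direction A b \<delta>h xh yh e)"

definition alternative_II ::
  "real^'n^'m \<Rightarrow> real^'m \<Rightarrow> real \<Rightarrow> real^'n \<Rightarrow> real^'m \<Rightarrow> bool" where
  "alternative_II A b \<delta>h xh yh \<longleftrightarrow> \<not> (\<exists>d. primal_direction A b \<delta>h xh yh d)"

definition alternative_III ::
  "real^'n^'m \<Rightarrow> real^'m \<Rightarrow> real \<Rightarrow> real \<Rightarrow> real^'n \<Rightarrow> real^'m \<Rightarrow> bool" where
  "alternative_III A b \<delta> \<delta>h xh yh \<longleftrightarrow>
     is_arg_max (\<lambda>(x, t). t) (primal_LP_feasible A b \<delta> \<delta>h yh) (xh, 0)"

definition alternative_IV ::
  "real^'n^'m \<Rightarrow> real^'m \<Rightarrow> real \<Rightarrow> real^'n \<Rightarrow> real^'m \<Rightarrow> bool" where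
  "alternative_IV A b \<delta>h xh yh \<longleftrightarrow>
     \<not> is_arg_min (\<lambda>y. - sign_vec (A *v xh - b) \<bullet> y) (dual_LP_feasible A b \<delta>h xh) yh"

end

theory Submission
  imports Defs
begin

text \<open>
  Alternatives (I) and (II) are the two sides of a Farkas alternative. The constraints on a dual
  direction \<open>e\<close> say that \<open>e\<close> makes a nonpositive product with finitely many vectors, and
  \<open>e\<close> exists unless the sign vector of the residual lies in the cone which these vectors
  generate; the coefficients of such a conic combination are, up to sign, a primal direction and
  its slacks. The cone is closed because it is finitely generated, so separation applies
  (\<open>farkas_alternative\<close>). That both directions cannot exist together is weak duality:
  the product \<open>e \<bullet> (A *v d)\<close> is negative when summed over rows and nonnegative when
  summed over columns.

  The two linear programs are the same systems in disguise: primal and dual directions are the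
  improving feasible directions of the programs in (III) and (IV) at \<open>(xh, 0)\<close> and
  \<open>yh\<close>. The difference between a better feasible point and the current one is such a
  direction (after division by the gain \<open>t\<close> in the primal program). Conversely, a
  sufficiently short step along a direction remains feasible: the inequalities on a direction
  keep the constraints active at the current point satisfied, and the inactive ones, finitely
  many, hold with strict inequality and survive a short step. By complementarity in the optimal
  pair, \<open>J_P xh \<subseteq> J_D A yh\<close> and \<open>I_D yh \<subseteq> I_P A b \<delta>h xh\<close>, and residual and
  dual variable have the same sign wherever the latter is nonzero; this makes the index sets
  distinguish active from inactive constraints. The bounds
  \<open>0 \<le> \<delta> < \<delta>h\<close> ensure that the residuals on \<open>I_P\<close> are nonzero and that
  the bound \<open>t \<le> \<delta>h - \<delta>\<close> is inactive at \<open>t = 0\<close>.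
\<close>

section \<open>Farkas' lemma and short steps\<close>

lemma farkas_alternative:
  fixes S :: "'a::euclidean_space set"
  assumes "finite S" and "\<And>e. (\<And>v. v \<in> S \<Longrightarrow> v \<bullet> e \<le> 0) \<Longrightarrow> x \<bullet> e \<le> 0"
  shows "x \<in> convex_cone hull S"
proof (rule ccontr)
  let ?C = "convex_cone hull S"
  assume "x \<notin> ?C"
  then obtain a \<beta> where less: "a \<bullet> x < \<beta>" and greater: "\<And>y. y \<in> ?C \<Longrightarrow> a \<bullet> y > \<beta>"
    using separating_hyperplane_closed_point[OF convex_convex_cone_hull
        closed_convex_cone_hull[OF \<open>finite S\<close>]] by blast
  have "\<beta> < 0"
    using greater[OF convex_cone_hull_contains_0] by simp
  have nonneg: "a \<bullet> v \<ge> 0" if "v \<in> S" for v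
  proof (rule ccontr)
    assume "\<not> a \<bullet> v \<ge> 0"
    \<comment> \<open>otherwise the multiple of \<open>v\<close> on which \<open>a\<close> takes the value \<open>\<beta>\<close> is in the cone\<close>
    then have "(\<beta> / (a \<bullet> v)) *\<^sub>R v \<in> ?C"
      using \<open>\<beta> < 0\<close> that by (intro convex_cone_hull_mul hull_inc) (auto simp: divide_nonpos_neg)
    from greater[OF this] \<open>\<not> a \<bullet> v \<ge> 0\<close> show False by simp
  qed
  have "x \<bullet> - a \<le> 0"
    using nonneg by (intro assms(2)) (simp add: inner_commute)
  with less \<open>\<beta> < 0\<close> show False by (simp add: inner_commute)
qed

text \<open>A strict inequality survives short steps; it is applied to the inactive constraints.\<close>

lemma eventually_short_step_less:
  fixes u v :: real
  assumes "u < v"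
  shows "\<forall>\<^sub>F t in at_right 0. u + t * p < v + t * q"
proof -
  have "((\<lambda>t. v + t * q - (u + t * p)) \<longlongrightarrow> v + 0 * q - (u + 0 * p)) (at_right 0)"
    by (intro tendsto_intros)
  then have "\<forall>\<^sub>F t in at_right 0. 0 < v + t * q - (u + t * p)"
    using assms by (intro order_tendstoD) auto
  then show ?thesis by (rule eventually_mono) simp
qed

lemma eventually_at_right_0_pos: "\<forall>\<^sub>F t in at_right (0::real). 0 < t"
  by (simp add: eventually_at_right_less)

lemma inner_matrix_vector_mult_columns:
  fixes A :: "real^'n^'m"
  shows "e \<bullet> (A *v d) = (\<Sum>j\<in>UNIV. d $ j * (column j A \<bullet> e))"
  by (simp add: matrix_mult_sum inner_sum_right scalar_mult_eq_scaleR inner_commute)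

section \<open>Complementarity in an optimal pair\<close>

locale positive_optimal_pair =
  fixes A :: "real^'n^'m" and b :: "real^'m" and \<delta>h :: real
    and xh :: "real^'n" and yh :: "real^'m"
  assumes optimal: "optimal_pair A b \<delta>h xh yh"
    and pos: "0 < \<delta>h"
begin

abbreviation res :: "'m \<Rightarrow> real" where
  "res i \<equiv> (A *v xh) $ i - b $ i"

abbreviation sgn_res :: "'m \<Rightarrow> real" where
  "sgn_res i \<equiv> sgn (res i)"

abbreviation col_yh :: "'n \<Rightarrow> real" where
  "col_yh j \<equiv> column j A \<bullet> yh"

lemma transpose_mult_yh: "(yh v* A) $ j = col_yh j"
  by (simp add: vector_matrix_mult_def column_def inner_vec_def mult.commute)

lemma abs_col_yh_le: "\<bar>col_yh j\<bar> \<le> 1"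
  and col_yh_J_P: "xh $ j \<noteq> 0 \<Longrightarrow> col_yh j = - sgn (xh $ j)"
  using optimal unfolding optimal_pair_def Sign_def
  by (auto simp: transpose_mult_yh abs_le_iff dest!: spec[of _ j])

lemma abs_res_le: "\<bar>res i\<bar> \<le> \<delta>h"
  and res_I_D: "yh $ i \<noteq> 0 \<Longrightarrow> res i = \<delta>h * sgn (yh $ i)"
proof -
  obtain \<xi> where \<xi>: "A *v xh - b = \<delta>h *\<^sub>R \<xi>" "\<xi> \<in> Sign yh"
    using optimal unfolding optimal_pair_def by blast
  have res: "res i = \<delta>h * \<xi> $ i"
    using arg_cong[OF \<xi>(1), of "\<lambda>v. v $ i"] by simp
  have \<xi>i: "\<bar>\<xi> $ i\<bar> \<le> 1" "yh $ i \<noteq> 0 \<Longrightarrow> \<xi> $ i = sgn (yh $ i)"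
    using \<xi>(2) unfolding Sign_def by (auto simp: abs_le_iff dest!: spec[of _ i])
  show "\<bar>res i\<bar> \<le> \<delta>h"
    using \<xi>i(1) pos by (simp add: res abs_mult mult_left_le)
  show "res i = \<delta>h * sgn (yh $ i)" if "yh $ i \<noteq> 0"
    using \<xi>i(2)[OF that] res by simp
qed

lemma sgn_res_I_D: "yh $ i \<noteq> 0 \<Longrightarrow> sgn_res i = sgn (yh $ i)"
  using res_I_D[of i] pos by (simp add: sgn_mult)

lemma J_P_subset_J_D: "J_P xh \<subseteq> J_D A yh"
  using col_yh_J_P by (auto simp: J_P_def J_D_def sgn_if)

lemma I_D_subset_I_P: "I_D yh \<subseteq> I_P A b \<delta>h xh"
  using res_I_D pos by (auto simp: I_D_def I_P_def abs_mult sgn_if)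

lemma sgn_res_I_P:
  assumes "i \<in> I_P A b \<delta>h xh"
  shows "sgn_res i * sgn_res i = 1" and "res i = \<delta>h * sgn_res i"
  using assms pos by (auto simp: I_P_def sgn_if)

lemma col_yh_J_D: "j \<in> J_D A yh \<Longrightarrow> col_yh j * col_yh j = 1"
  by (auto simp: J_D_def abs_if split: if_splits)

lemma sign_vec_res_inner: "sign_vec (A *v xh - b) \<bullet> e = (\<Sum>i\<in>UNIV. sgn_res i * e $ i)"
  by (simp add: sign_vec_def inner_vec_def)

section \<open>Primal and dual directions exclude each other\<close>

text \<open>
  Weak duality: evaluated by rows, \<open>e \<bullet> (A *v d)\<close> is at most
  \<open>- sign_vec (A *v xh - b) \<bullet> e\<close>; evaluated by columns, it is nonnegative.
\<close>

lemma directions_exclusive: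
  assumes e: "dual_direction A b \<delta>h xh yh e" and d: "primal_direction A b \<delta>h xh yh d"
  shows False
proof -
  have row: "e $ i * (A *v d) $ i \<le> - (sgn_res i * e $ i)" for i
  proof -
    consider (D) "i \<in> I_D yh" | (PD) "i \<in> I_P A b \<delta>h xh - I_D yh" | (N) "i \<notin> I_P A b \<delta>h xh"
      by blast
    then show ?thesis
    proof cases
      case D
      then have "(A *v d) $ i = - sgn_res i"
        using d sgn_res_I_D by (simp add: primal_direction_def I_D_def)
      then show ?thesis by simp
    next
      case PD
      have "(sgn_res i * e $ i) * (sgn_res i * (A *v d) $ i) \<le> (sgn_res i * e $ i) * - 1"
        using PD e d by (intro mult_left_mono) (auto simp: primal_direction_def dual_direction_def)
      moreover have "(sgn_res i * e $ i) * (sgn_res i * (A *v d) $ i)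
          = (sgn_res i * sgn_res i) * (e $ i * (A *v d) $ i)"
        by (simp only: mult_ac)
      ultimately show ?thesis using sgn_res_I_P(1)[of i] PD by simp
    next
      case N
      then show ?thesis using e by (simp add: dual_direction_def)
    qed
  qed
  have col: "0 \<le> d $ j * (column j A \<bullet> e)" for j
  proof -
    consider (P) "j \<in> J_P xh" | (DP) "j \<in> J_D A yh - J_P xh" | (N) "j \<notin> J_D A yh"
      by blast
    then show ?thesis
    proof cases
      case DP
      have "0 \<le> (col_yh j * d $ j) * (col_yh j * (column j A \<bullet> e))"
        using DP e d by (intro mult_nonpos_nonpos) (auto simp: primal_direction_def dual_direction_def)
      also have "\<dots> = (col_yh j * col_yh j) * (d $ j * (column j A \<bullet> e))"
        by (simp only: mult_ac)
      finally show ?thesis using col_yh_J_D[of j] DP by simp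
    qed (use e d in \<open>auto simp: primal_direction_def dual_direction_def\<close>)
  qed
  have "0 \<le> e \<bullet> (A *v d)"
    by (simp add: inner_matrix_vector_mult_columns sum_nonneg col)
  also have "e \<bullet> (A *v d) = (\<Sum>i\<in>UNIV. e $ i * (A *v d) $ i)"
    by (simp add: inner_vec_def)
  also have "\<dots> \<le> (\<Sum>i\<in>UNIV. - (sgn_res i * e $ i))"
    by (intro sum_mono row)
  also have "\<dots> = - sign_vec (A *v xh - b) \<bullet> e"
    by (simp add: sign_vec_res_inner sum_negf)
  also have "\<dots> < 0"
    using e by (simp add: dual_direction_def)
  finally show False by simp
qed

section \<open>One of the two directions exists\<close>

text \<open>
  The generators below are those vectors whose nonpositive product with \<open>e\<close> expresses the
  homogeneous constraints on a dual direction; equality constraints contribute both signs.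
\<close>

definition generators :: "(real^'m) set" where
  "generators =
     (\<lambda>j. column j A) ` J_P xh \<union> (\<lambda>j. - column j A) ` J_P xh \<union>
     (\<lambda>j. col_yh j *\<^sub>R column j A) ` (J_D A yh - J_P xh) \<union>
     (\<lambda>i. axis i (- sgn_res i)) ` (I_P A b \<delta>h xh - I_D yh) \<union>
     (\<lambda>i. axis i 1) ` (- I_P A b \<delta>h xh) \<union> (\<lambda>i. axis i (- 1)) ` (- I_P A b \<delta>h xh)"

lemma finite_generators: "finite generators"
  by (simp add: generators_def)

lemma dual_direction_iff_generators:
  "dual_direction A b \<delta>h xh yh e \<longleftrightarrow>
     sign_vec (A *v xh - b) \<bullet> e > 0 \<and> (\<forall>v\<in>generators. v \<bullet> e \<le> 0)"
  unfolding dual_direction_def generators_def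
  by (auto simp: ball_Un inner_axis' antisym_conv)

text \<open>
  Conic combinations of the generators, written with the coefficients \<open>d\<close> of the columns and
  the combination \<open>q\<close> of the unit vectors. Since this set is a convex cone and contains
  the generators, it contains their conic hull; no sum over the generators has to be manipulated.
\<close>

definition column_slack_cone :: "(real^'m) set" where
  "column_slack_cone = {A *v d + q |d q.
     (\<forall>j\<in>J_D A yh - J_P xh. 0 \<le> col_yh j * d $ j) \<and> (\<forall>j\<in>- J_D A yh. d $ j = 0) \<and>
     (\<forall>i\<in>I_D yh. q $ i = 0) \<and> (\<forall>i\<in>I_P A b \<delta>h xh - I_D yh. sgn_res i * q $ i \<le> 0)}"

lemma convex_cone_column_slack_cone: "convex_cone column_slack_cone"
  unfolding convex_cone_iff
proof (intro conjI ballI allI impI)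
  show "0 \<in> column_slack_cone"
    unfolding column_slack_cone_def by (auto intro!: exI[of _ 0])
next
  fix u v assume "u \<in> column_slack_cone" "v \<in> column_slack_cone"
  then obtain d q d' q' where
    "u = A *v d + q" "v = A *v d' + q'"
    "\<forall>j\<in>J_D A yh - J_P xh. 0 \<le> col_yh j * d $ j" "\<forall>j\<in>- J_D A yh. d $ j = 0"
    "\<forall>i\<in>I_D yh. q $ i = 0" "\<forall>i\<in>I_P A b \<delta>h xh - I_D yh. sgn_res i * q $ i \<le> 0"
    "\<forall>j\<in>J_D A yh - J_P xh. 0 \<le> col_yh j * d' $ j" "\<forall>j\<in>- J_D A yh. d' $ j = 0"
    "\<forall>i\<in>I_D yh. q' $ i = 0" "\<forall>i\<in>I_P A b \<delta>h xh - I_D yh. sgn_res i * q' $ i \<le> 0"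
    unfolding column_slack_cone_def by blast
  then show "u + v \<in> column_slack_cone"
    unfolding column_slack_cone_def mem_Collect_eq
    by (intro exI[of _ "d + d'"] exI[of _ "q + q'"] conjI)
       (simp_all add: matrix_vector_right_distrib distrib_left add_nonpos_nonpos)
next
  fix u and k :: real assume "u \<in> column_slack_cone" "0 \<le> k"
  then obtain d q where
    "u = A *v d + q"
    "\<forall>j\<in>J_D A yh - J_P xh. 0 \<le> col_yh j * d $ j" "\<forall>j\<in>- J_D A yh. d $ j = 0"
    "\<forall>i\<in>I_D yh. q $ i = 0" "\<forall>i\<in>I_P A b \<delta>h xh - I_D yh. sgn_res i * q $ i \<le> 0"
    unfolding column_slack_cone_def by blast
  with \<open>0 \<le> k\<close> show "k *\<^sub>R u \<in> column_slack_cone"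
    unfolding column_slack_cone_def mem_Collect_eq
    by (intro exI[of _ "k *\<^sub>R d"] exI[of _ "k *\<^sub>R q"] conjI)
       (simp_all add: matrix_vector_mult_scaleR scaleR_right_distrib mult.left_commute[of _ k]
          mult_nonneg_nonpos)
qed

lemma column_in_column_slack_cone:
  assumes "j \<in> J_D A yh" and "j \<notin> J_P xh \<Longrightarrow> 0 \<le> col_yh j * k"
  shows "k *\<^sub>R column j A \<in> column_slack_cone"
  unfolding column_slack_cone_def mem_Collect_eq
  using assms
  by (intro exI[of _ "k *\<^sub>R axis j 1"] exI[of _ 0])
     (auto simp: matrix_vector_mult_scaleR matrix_vector_mult_basis, auto simp: axis_def)

lemma axis_in_column_slack_cone:
  assumes "i \<notin> I_D yh" and "i \<in> I_P A b \<delta>h xh \<Longrightarrow> sgn_res i * k \<le> 0"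
  shows "axis i k \<in> column_slack_cone"
  unfolding column_slack_cone_def mem_Collect_eq
  using assms by (intro exI[of _ 0] exI[of _ "axis i k"]) (auto simp: axis_def)

lemma generators_subset_column_slack_cone: "generators \<subseteq> column_slack_cone"
proof -
  have "column j A \<in> column_slack_cone" "- column j A \<in> column_slack_cone" if "j \<in> J_P xh" for j
    using column_in_column_slack_cone[of j 1] column_in_column_slack_cone[of j "- 1"]
      that J_P_subset_J_D by auto
  moreover have "col_yh j *\<^sub>R column j A \<in> column_slack_cone" if "j \<in> J_D A yh - J_P xh" for j
    using that by (intro column_in_column_slack_cone) auto
  moreover have "axis i (- sgn_res i) \<in> column_slack_cone" if "i \<in> I_P A b \<delta>h xh - I_D yh" for i
    using that sgn_res_I_P(1)[of i] by (intro axis_in_column_slack_cone) auto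
  moreover have "axis i k \<in> column_slack_cone" if "i \<notin> I_P A b \<delta>h xh" for i k
    using that I_D_subset_I_P by (intro axis_in_column_slack_cone) auto
  ultimately show ?thesis
    unfolding generators_def by auto
qed

text \<open>
  If the sign vector of the residual is \<open>A *v d + q\<close>, then \<open>A *v - d\<close> is its negative plus the
  slack \<open>q\<close>, which vanishes on \<open>I_D\<close> and on the rest of \<open>I_P\<close> has the sign that the inequality of
  a primal direction needs.
\<close>

lemma primal_direction_of_column_slack_cone:
  assumes "sign_vec (A *v xh - b) \<in> column_slack_cone"
  shows "\<exists>d. primal_direction A b \<delta>h xh yh d"
proof -
  obtain d q where eq: "sign_vec (A *v xh - b) = A *v d + q"
    and d: "\<forall>j\<in>J_D A yh - J_P xh. 0 \<le> col_yh j * d $ j" "\<forall>j\<in>- J_D A yh. d $ j = 0"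
    and q: "\<forall>i\<in>I_D yh. q $ i = 0" "\<forall>i\<in>I_P A b \<delta>h xh - I_D yh. sgn_res i * q $ i \<le> 0"
    using assms unfolding column_slack_cone_def by blast
  have Ad: "(A *v - d) $ i = q $ i - sgn_res i" for i
    using arg_cong[OF eq, of "\<lambda>v. v $ i"]
    by (simp add: sign_vec_def matrix_vector_mult_scaleR[of A "- 1" d, simplified])
  have "sgn_res i * (A *v - d) $ i \<le> - 1" if "i \<in> I_P A b \<delta>h xh - I_D yh" for i
    using that q(2) sgn_res_I_P(1)[of i] by (auto simp: Ad right_diff_distrib)
  moreover have "(A *v - d) $ i = - sgn (yh $ i)" if "i \<in> I_D yh" for i
    using that q(1) sgn_res_I_D[of i] by (simp add: Ad I_D_def)
  ultimately have "primal_direction A b \<delta>h xh yh (- d)"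
    using d unfolding primal_direction_def by simp
  then show ?thesis ..
qed

lemma alternative_I_iff_II: "alternative_I A b \<delta>h xh yh \<longleftrightarrow> alternative_II A b \<delta>h xh yh"
proof
  assume "alternative_I A b \<delta>h xh yh"
  then show "alternative_II A b \<delta>h xh yh"
    using directions_exclusive unfolding alternative_I_def alternative_II_def by blast
next
  assume II: "alternative_II A b \<delta>h xh yh"
  show "alternative_I A b \<delta>h xh yh"
  proof (rule ccontr)
    assume "\<not> alternative_I A b \<delta>h xh yh"
    then have "sign_vec (A *v xh - b) \<in> convex_cone hull generators"
      unfolding alternative_I_def dual_direction_iff_generators
      by (intro farkas_alternative finite_generators) (meson not_le)
    then have "sign_vec (A *v xh - b) \<in> column_slack_cone"
      using hull_minimal[of generators column_slack_cone convex_cone]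
        generators_subset_column_slack_cone convex_cone_column_slack_cone by blast
    then show False
      using primal_direction_of_column_slack_cone II unfolding alternative_II_def by blast
  qed
qed

section \<open>The primal linear program\<close>

lemma primal_LP_feasible_start:
  assumes "\<delta> \<le> \<delta>h"
  shows "primal_LP_feasible A b \<delta> \<delta>h yh (xh, 0)"
proof -
  have "col_yh j * xh $ j \<le> 0" for j
  proof (cases "xh $ j = 0")
    case False
    show ?thesis unfolding col_yh_J_P[OF False] by (simp add: sgn_if)
  qed simp
  moreover have "- \<delta>h \<le> res i" "res i \<le> \<delta>h" for i
    using abs_res_le[of i] by auto
  moreover have "xh $ j = 0" if "j \<in> - J_D A yh" for j
    using that J_P_subset_J_D by (auto simp: J_P_def)
  moreover have "res i = \<delta>h * sgn (yh $ i)" if "i \<in> I_D yh" for i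
    using that by (intro res_I_D) (simp add: I_D_def)
  ultimately show ?thesis
    using assms unfolding primal_LP_feasible_def by (simp add: transpose_mult_yh)
qed

text \<open>
  On \<open>I_P\<close> the current residual has modulus \<open>\<delta>h\<close>, so lowering the bound by \<open>t\<close> forces the residual
  to move inwards by at least \<open>t\<close>; division by \<open>t\<close> normalises this to the bound \<open>- 1\<close>.
\<close>

lemma primal_direction_of_gain:
  assumes feas: "primal_LP_feasible A b \<delta> \<delta>h yh (x, t)" and t: "0 < t"
  shows "primal_direction A b \<delta>h xh yh ((1 / t) *\<^sub>R (x - xh))"
proof -
  let ?d = "(1 / t) *\<^sub>R (x - xh)"
  have Ad: "(A *v ?d) $ i = ((A *v x) $ i - b $ i - res i) / t" for i
    by (simp add: matrix_vector_mult_scaleR matrix_vector_mult_diff_distrib)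
  have "(A *v ?d) $ i = - sgn (yh $ i)" if "i \<in> I_D yh" for i
  proof -
    have "(A *v x) $ i - b $ i = (\<delta>h - t) * sgn (yh $ i)"
      using feas that by (simp add: primal_LP_feasible_def)
    moreover have "res i = \<delta>h * sgn (yh $ i)"
      using that by (intro res_I_D) (simp add: I_D_def)
    ultimately have "(A *v x) $ i - b $ i - res i = t * - sgn (yh $ i)"
      by (simp add: left_diff_distrib)
    then show ?thesis using t by (simp add: Ad)
  qed
  moreover have "sgn_res i * (A *v ?d) $ i \<le> - 1" if i: "i \<in> I_P A b \<delta>h xh - I_D yh" for i
  proof -
    have "\<bar>(A *v x) $ i - b $ i\<bar> \<le> \<delta>h - t"
      using feas i unfolding primal_LP_feasible_def by (force intro: abs_leI)
    then have "sgn_res i * ((A *v x) $ i - b $ i - res i) \<le> - t"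
      using i pos by (auto simp: I_P_def sgn_if split: if_splits)
    then show ?thesis
      using t by (simp add: Ad divide_le_eq)
  qed
  moreover have "col_yh j * ?d $ j \<le> 0" if "j \<in> J_D A yh - J_P xh" for j
  proof -
    have "col_yh j * x $ j \<le> 0"
      using feas by (simp add: primal_LP_feasible_def transpose_mult_yh)
    then show ?thesis
      using that t by (simp add: J_P_def divide_nonpos_pos)
  qed
  moreover have "?d $ j = 0" if "j \<in> - J_D A yh" for j
    using that feas J_P_subset_J_D by (auto simp: primal_LP_feasible_def J_P_def)
  ultimately show ?thesis
    unfolding primal_direction_def by blast
qed

text \<open>
  Along a short step in a primal direction the residuals on \<open>I_P\<close> shrink at least as fast as the bound
  \<open>\<delta>h - t\<close>; the others start strictly below the bound.
\<close>

lemma eventually_primal_step_row: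
  assumes d: "primal_direction A b \<delta>h xh yh d" and i: "i \<notin> I_D yh"
  shows "\<forall>\<^sub>F t in at_right 0. t - \<delta>h \<le> res i + t * (A *v d) $ i \<and> res i + t * (A *v d) $ i \<le> \<delta>h - t"
proof (cases "i \<in> I_P A b \<delta>h xh")
  case False
  then have "\<bar>res i\<bar> < \<delta>h"
    using abs_res_le[of i] by (simp add: I_P_def)
  then have "- \<delta>h < res i" "res i < \<delta>h" by auto
  show ?thesis
    using eventually_short_step_less[OF \<open>- \<delta>h < res i\<close>, of 1 "(A *v d) $ i"]
      eventually_short_step_less[OF \<open>res i < \<delta>h\<close>, of "(A *v d) $ i" "- 1"]
    by eventually_elim simp
next
  case True
  then have slope: "sgn_res i * (A *v d) $ i \<le> - 1"
    using d i by (simp add: primal_direction_def)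
  \<comment> \<open>the residual sits on one of the two bounds and is strictly inside the other\<close>
  consider "res i = \<delta>h" | "res i = - \<delta>h"
    using True by (auto simp: I_P_def abs_if split: if_splits)
  then show ?thesis
  proof cases
    case 1
    then have "(A *v d) $ i \<le> - 1" using slope pos by simp
    then have bound: "t * (A *v d) $ i \<le> - t" if "0 < t" for t
      using mult_left_mono[of "(A *v d) $ i" "- 1" t] that by simp
    have "- \<delta>h < \<delta>h" using pos by simp
    from eventually_at_right_0_pos eventually_short_step_less[OF this, of 1 "(A *v d) $ i"]
    show ?thesis
    proof eventually_elim
      case (elim t)
      then show ?case using 1 bound[of t] by auto
    qed
  next
    case 2
    then have "1 \<le> (A *v d) $ i" using slope pos by simp
    then have bound: "t \<le> t * (A *v d) $ i" if "0 < t" for t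
      using mult_left_mono[of 1 "(A *v d) $ i" t] that by simp
    have "- \<delta>h < \<delta>h" using pos by simp
    from eventually_at_right_0_pos eventually_short_step_less[OF this, of "(A *v d) $ i" "- 1"]
    show ?thesis
    proof eventually_elim
      case (elim t)
      then show ?case using 2 bound[of t] by auto
    qed
  qed
qed

lemma eventually_primal_step_column:
  assumes d: "primal_direction A b \<delta>h xh yh d"
  shows "\<forall>\<^sub>F t in at_right 0. col_yh j * (xh $ j + t * d $ j) \<le> 0"
proof -
  consider (P) "j \<in> J_P xh" | (DP) "j \<in> J_D A yh - J_P xh" | (N) "j \<notin> J_D A yh"
    by blast
  then show ?thesis
  proof cases
    case P
    then have "col_yh j * xh $ j < 0"
      using col_yh_J_P[of j] by (simp add: J_P_def abs_sgn[symmetric] mult.commute)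
    then show ?thesis
      using eventually_short_step_less[of "col_yh j * xh $ j" 0 "col_yh j * d $ j" 0]
      by (auto elim!: eventually_mono simp: algebra_simps)
  next
    case DP
    then have "xh $ j = 0" "col_yh j * d $ j \<le> 0"
      using d by (auto simp: primal_direction_def J_P_def)
    then show ?thesis
      by (auto intro!: eventually_mono[OF eventually_at_right_0_pos] mult_nonneg_nonpos
            simp: mult.left_commute[of "col_yh j"])
  next
    case N
    then have "xh $ j = 0" "d $ j = 0"
      using d J_P_subset_J_D by (auto simp: primal_direction_def J_P_def)
    then show ?thesis by simp
  qed
qed

lemma gain_of_primal_direction:
  assumes d: "primal_direction A b \<delta>h xh yh d" and \<delta>: "\<delta> < \<delta>h"
  shows "\<exists>x t. primal_LP_feasible A b \<delta> \<delta>h yh (x, t) \<and> 0 < t"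
proof -
  have "\<forall>\<^sub>F t in at_right 0. \<forall>i. i \<notin> I_D yh \<longrightarrow>
      t - \<delta>h \<le> res i + t * (A *v d) $ i \<and> res i + t * (A *v d) $ i \<le> \<delta>h - t"
    using eventually_primal_step_row[OF d] by (intro eventually_all_finite) (auto intro: eventually_mono)
  moreover have "\<forall>\<^sub>F t in at_right 0. \<forall>j. col_yh j * (xh $ j + t * d $ j) \<le> 0"
    by (intro eventually_all_finite eventually_primal_step_column[OF d])
  moreover have "\<forall>\<^sub>F t in at_right 0. 0 + t * 1 < (\<delta>h - \<delta>) + t * 0"
    using \<delta> by (intro eventually_short_step_less) simp
  ultimately have "\<forall>\<^sub>F t in at_right 0. primal_LP_feasible A b \<delta> \<delta>h yh (xh + t *\<^sub>R d, t) \<and> 0 < t"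
    using eventually_at_right_0_pos
  proof eventually_elim
    case (elim t)
    have Ax: "(A *v (xh + t *\<^sub>R d)) $ i - b $ i = res i + t * (A *v d) $ i" for i
      by (simp add: matrix_vector_right_distrib matrix_vector_mult_scaleR)
    have "res i + t * (A *v d) $ i = (\<delta>h - t) * sgn (yh $ i)" if "i \<in> I_D yh" for i
      using that res_I_D[of i] d by (simp add: I_D_def primal_direction_def left_diff_distrib)
    moreover have "xh $ j + t * d $ j = 0" if "j \<in> - J_D A yh" for j
      using that d J_P_subset_J_D by (auto simp: primal_direction_def J_P_def)
    ultimately show ?case
      using elim unfolding primal_LP_feasible_def
      by (simp add: Ax transpose_mult_yh)
  qed
  then show ?thesis
    using eventually_happens'[OF trivial_limit_at_right_real] by blast
qed

lemma alternative_II_iff_III: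
  assumes "\<delta> < \<delta>h"
  shows "alternative_II A b \<delta>h xh yh \<longleftrightarrow> alternative_III A b \<delta> \<delta>h xh yh"
proof -
  have "(\<exists>d. primal_direction A b \<delta>h xh yh d) \<longleftrightarrow>
      (\<exists>x t. primal_LP_feasible A b \<delta> \<delta>h yh (x, t) \<and> 0 < t)"
    using primal_direction_of_gain gain_of_primal_direction[OF _ assms] by blast
  then show ?thesis
    using primal_LP_feasible_start[of \<delta>] assms
    unfolding alternative_II_def alternative_III_def is_arg_max_def by auto
qed

section \<open>The dual linear program\<close>

lemma dual_LP_feasible_start: "dual_LP_feasible A b \<delta>h xh yh"
proof -
  have "- sgn_res i * yh $ i \<le> 0" for i
  proof (cases "yh $ i = 0")
    case False
    show ?thesis unfolding sgn_res_I_D[OF False] by (simp add: sgn_if)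
  qed simp
  moreover have "yh $ i = 0" if "i \<in> - I_P A b \<delta>h xh" for i
    using that I_D_subset_I_P by (auto simp: I_D_def)
  moreover have "- 1 \<le> - col_yh j" "- col_yh j \<le> 1" for j
    using abs_col_yh_le[of j] by auto
  moreover have "- col_yh j = sgn (xh $ j)" if "j \<in> J_P xh" for j
    using that col_yh_J_P[of j] by (simp add: J_P_def)
  ultimately show ?thesis
    unfolding dual_LP_feasible_def by blast
qed

text \<open>
  For \<open>j \<in> J_D A yh\<close> the value \<open>column j A \<bullet> yh\<close> is an endpoint of the interval from \<open>- 1\<close> to \<open>1\<close>,
  so from there a feasible point can only be reached by moving towards zero, that is, against its sign.
\<close>

lemma dual_direction_of_gain:
  assumes feas: "dual_LP_feasible A b \<delta>h xh y"
    and gain: "- sign_vec (A *v xh - b) \<bullet> y < - sign_vec (A *v xh - b) \<bullet> yh"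
  shows "dual_direction A b \<delta>h xh yh (y - yh)"
proof -
  have "col_yh j * (column j A \<bullet> (y - yh)) \<le> 0" if j: "j \<in> J_D A yh - J_P xh" for j
  proof -
    have "\<bar>column j A \<bullet> y\<bar> \<le> 1"
      using feas j by (auto simp: dual_LP_feasible_def abs_le_iff)
    moreover have "\<bar>col_yh j\<bar> = 1" using j by (simp add: J_D_def)
    ultimately have "col_yh j * (column j A \<bullet> y) \<le> col_yh j * col_yh j"
      by (auto simp: abs_if split: if_splits)
    then show ?thesis by (simp add: inner_diff_right right_diff_distrib)
  qed
  moreover have "- sgn_res i * (y - yh) $ i \<le> 0" if "i \<in> I_P A b \<delta>h xh - I_D yh" for i
    using that feas by (simp add: dual_LP_feasible_def I_D_def)
  moreover have "column j A \<bullet> (y - yh) = 0" if "j \<in> J_P xh" for j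
  proof -
    have "- (column j A \<bullet> y) = - col_yh j"
      using that feas col_yh_J_P[of j] by (simp add: dual_LP_feasible_def J_P_def)
    then show ?thesis by (simp add: inner_diff_right)
  qed
  moreover have "(y - yh) $ i = 0" if "i \<in> - I_P A b \<delta>h xh" for i
    using that feas I_D_subset_I_P by (auto simp: dual_LP_feasible_def I_D_def)
  moreover have "- sign_vec (A *v xh - b) \<bullet> (y - yh) < 0"
    using gain by (simp only: inner_diff_right diff_less_0_iff_less)
  ultimately show ?thesis
    unfolding dual_direction_def by blast
qed

lemma eventually_dual_step_column:
  assumes e: "dual_direction A b \<delta>h xh yh e" and j: "j \<notin> J_P xh"
  shows "\<forall>\<^sub>F t in at_right 0. - 1 \<le> - (col_yh j + t * (column j A \<bullet> e)) \<and>
    - (col_yh j + t * (column j A \<bullet> e)) \<le> 1"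
proof (cases "j \<in> J_D A yh")
  case False
  then have "- 1 < col_yh j" "col_yh j < 1"
    using abs_col_yh_le[of j] by (auto simp: J_D_def abs_if split: if_splits)
  show ?thesis
    using eventually_short_step_less[OF \<open>- 1 < col_yh j\<close>, of 0 "column j A \<bullet> e"]
      eventually_short_step_less[OF \<open>col_yh j < 1\<close>, of "column j A \<bullet> e" 0]
    by eventually_elim simp
next
  case True
  then have slope: "col_yh j * (column j A \<bullet> e) \<le> 0"
    using e j by (simp add: dual_direction_def)
  consider "col_yh j = 1" | "col_yh j = - 1"
    using True by (auto simp: J_D_def abs_if split: if_splits)
  then show ?thesis
  proof cases
    case 1
    then have bound: "t * (column j A \<bullet> e) \<le> 0" if "0 < t" for t
      using slope that by (simp add: mult_nonneg_nonpos)
    have "(- 1 :: real) < 1" by simp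
    from eventually_at_right_0_pos eventually_short_step_less[OF this, of 0 "column j A \<bullet> e"]
    show ?thesis
    proof eventually_elim
      case (elim t)
      then show ?case using 1 bound[of t] by auto
    qed
  next
    case 2
    then have bound: "0 \<le> t * (column j A \<bullet> e)" if "0 < t" for t
      using slope that by simp
    have "(- 1 :: real) < 1" by simp
    from eventually_at_right_0_pos eventually_short_step_less[OF this, of "column j A \<bullet> e" 0]
    show ?thesis
    proof eventually_elim
      case (elim t)
      then show ?case using 2 bound[of t] by auto
    qed
  qed
qed

lemma eventually_dual_step_row:
  assumes e: "dual_direction A b \<delta>h xh yh e"
  shows "\<forall>\<^sub>F t in at_right 0. - sgn_res i * (yh $ i + t * e $ i) \<le> 0"
proof -
  consider (D) "i \<in> I_D yh" | (PD) "i \<in> I_P A b \<delta>h xh - I_D yh" | (N) "i \<notin> I_P A b \<delta>h xh"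
    by blast
  then show ?thesis
  proof cases
    case D
    then have "0 < sgn_res i * yh $ i"
      using sgn_res_I_D[of i] by (simp add: I_D_def sgn_if)
    then show ?thesis
      using eventually_short_step_less[of 0 "sgn_res i * yh $ i" 0 "sgn_res i * e $ i"]
      by (auto elim!: eventually_mono simp: algebra_simps)
  next
    case PD
    then have "yh $ i = 0" "0 \<le> sgn_res i * e $ i"
      using e by (auto simp: dual_direction_def I_D_def)
    then show ?thesis
      by (auto intro!: eventually_mono[OF eventually_at_right_0_pos]
            simp: mult.left_commute[of "sgn_res i"])
  next
    case N
    then have "yh $ i = 0" "e $ i = 0"
      using e I_D_subset_I_P by (auto simp: dual_direction_def I_D_def)
    then show ?thesis by simp
  qed
qed

lemma gain_of_dual_direction:
  assumes e: "dual_direction A b \<delta>h xh yh e"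
  shows "\<exists>y. dual_LP_feasible A b \<delta>h xh y \<and>
    - sign_vec (A *v xh - b) \<bullet> y < - sign_vec (A *v xh - b) \<bullet> yh"
proof -
  have "\<forall>\<^sub>F t in at_right 0. \<forall>j. j \<notin> J_P xh \<longrightarrow> - 1 \<le> - (col_yh j + t * (column j A \<bullet> e)) \<and>
      - (col_yh j + t * (column j A \<bullet> e)) \<le> 1"
    using eventually_dual_step_column[OF e] by (intro eventually_all_finite) (auto intro: eventually_mono)
  moreover have "\<forall>\<^sub>F t in at_right 0. \<forall>i. - sgn_res i * (yh $ i + t * e $ i) \<le> 0"
    by (intro eventually_all_finite eventually_dual_step_row[OF e])
  ultimately have "\<forall>\<^sub>F t in at_right 0. dual_LP_feasible A b \<delta>h xh (yh + t *\<^sub>R e) \<and>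
      - sign_vec (A *v xh - b) \<bullet> (yh + t *\<^sub>R e) < - sign_vec (A *v xh - b) \<bullet> yh"
    using eventually_at_right_0_pos
  proof eventually_elim
    case (elim t)
    have "dual_LP_feasible A b \<delta>h xh (yh + t *\<^sub>R e)"
      using elim(1,2) dual_LP_feasible_start e unfolding dual_LP_feasible_def dual_direction_def
      by (simp add: inner_add_right)
    moreover have "- sign_vec (A *v xh - b) \<bullet> (yh + t *\<^sub>R e) < - sign_vec (A *v xh - b) \<bullet> yh"
      using e elim(3) by (simp add: dual_direction_def inner_add_right)
    ultimately show ?case ..
  qed
  then show ?thesis
    using eventually_happens'[OF trivial_limit_at_right_real] by blast
qed

lemma alternative_I_iff_IV: "alternative_I A b \<delta>h xh yh \<longleftrightarrow> alternative_IV A b \<delta>h xh yh"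
  using dual_direction_of_gain gain_of_dual_direction dual_LP_feasible_start
  unfolding alternative_I_def alternative_IV_def is_arg_min_def by blast

end

section \<open>Equivalence of the four alternatives\<close>

theorem theorem2p2:
  fixes A :: "real^'n^'m" and b :: "real^'m" and \<delta> \<delta>h :: real
    and xh :: "real^'n" and yh :: "real^'m"
  assumes "0 \<le> \<delta>" and "\<delta> < infnorm b"
    and "0 \<le> \<delta>h" and "\<delta>h < infnorm b"
    and "\<delta> < \<delta>h"
    and "optimal_pair A b \<delta>h xh yh"
  shows "(alternative_I A b \<delta>h xh yh \<longleftrightarrow> alternative_II A b \<delta>h xh yh) \<and>
         (alternative_II A b \<delta>h xh yh \<longleftrightarrow> alternative_III A b \<delta> \<delta>h xh yh) \<and>
         (alternative_III A b \<delta> \<delta>h xh yh \<longleftrightarrow> alternative_IV A b \<delta>h xh yh)"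
proof -
  interpret positive_optimal_pair A b \<delta>h xh yh
    using assms by unfold_locales auto
  show ?thesis
    using alternative_I_iff_II alternative_II_iff_III[OF \<open>\<delta> < \<delta>h\<close>] alternative_I_iff_IV by blast
qed

end
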